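(* Let $X$ be a real Banach space and suppose that $x\in S_X$ and $f\in S_{X^*}$ are such that $f(x)=1$. Then the following conditions are equivalent: (i) $f$ $\omega$-exposes $x$. (ii) For each closed convex set $C\subset B_X$ such that $\sup_{y\in C} f(y)=1$ it holds that $x\in C$. (iii) $f$ is a G-smooth point in $X^*$, i.e. there is a unique $\psi\in S_{X^{**}}$ such that $\psi(f)=1$.
   Context: For a real Banach space $X$, $B_X=\{x\in X:\|x\|\le 1\}$ is the closed unit ball, $S_X=\{x\in X:\|x\|=1\}$ is the unit sphere, $X^*$ is the dual and $X^{**}$ the bidual. A functional $f\in S_{X^*}$ is said to $\omega$-expose a point $x\in S_X$ if whenever $(x_n)\subset B_X$ is a sequence with $\lim_{n\to\infty} f(x_n)=1$, then $x_n\to x$ in the weak topology of $X$. "Closed" in (ii) refers to the norm topology. *)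

theory Defs
  imports "HOL-Analysis.Analysis"
begin

text \<open>The coarsest topology on the space making every continuous linear functional continuous:
  the topology on the function type is the product topology, as in \<^const>\<open>strong_operator_topology\<close>.\<close>

definition weak_topology :: "'a::real_normed_vector topology" where
  "weak_topology = pullback_topology UNIV (\<lambda>x (\<phi> :: 'a \<Rightarrow>\<^sub>L real). blinfun_apply \<phi> x) euclidean"

lemma limitin_weak_topology:
  "limitin weak_topology u x F \<longleftrightarrow>
     (\<forall>\<phi> :: 'a::real_normed_vector \<Rightarrow>\<^sub>L real. ((\<lambda>n. blinfun_apply \<phi> (u n)) \<longlongrightarrow> blinfun_apply \<phi> x) F)"
proof -
  let ?e = "\<lambda>x (\<phi> :: 'a \<Rightarrow>\<^sub>L real). blinfun_apply \<phi> x"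
  have op: "openin weak_topology U \<longleftrightarrow> (\<exists>V. open V \<and> U = ?e -` V)" for U :: "'a set"
    by (simp add: weak_topology_def openin_pullback_topology)
  have top: "topspace (weak_topology :: 'a topology) = UNIV"
    by (simp add: weak_topology_def topspace_pullback_topology)
  have "limitin weak_topology u x F \<longleftrightarrow> limitin euclidean (\<lambda>n. ?e (u n)) (?e x) F"
    by (auto simp: limitin_def op top)
  also have "\<dots> \<longleftrightarrow> limitin (product_topology (\<lambda>_. euclidean) UNIV) (\<lambda>n. ?e (u n)) (?e x) F"
    by (simp only: euclidean_product_topology)
  also have "\<dots> \<longleftrightarrow> (\<forall>\<phi> :: 'a \<Rightarrow>\<^sub>L real. ((\<lambda>n. blinfun_apply \<phi> (u n)) \<longlongrightarrow> blinfun_apply \<phi> x) F)"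
    by (simp add: limitin_componentwise)
  finally show ?thesis .
qed

definition weakly_exposes :: "('a::real_normed_vector \<Rightarrow>\<^sub>L real) \<Rightarrow> 'a \<Rightarrow> bool" where
  "weakly_exposes f x \<longleftrightarrow> f \<in> sphere 0 1 \<and> x \<in> sphere 0 1 \<and>
     (\<forall>u :: nat \<Rightarrow> 'a. (\<forall>n. u n \<in> cball 0 1) \<longrightarrow> (\<lambda>n. blinfun_apply f (u n)) \<longlonglongrightarrow> 1 \<longrightarrow>
        limitin weak_topology u x sequentially)"

definition G_smooth_point :: "'a::real_normed_vector \<Rightarrow> bool" where
  "G_smooth_point z \<longleftrightarrow> (\<exists>!\<psi> :: 'a \<Rightarrow>\<^sub>L real. \<psi> \<in> sphere 0 1 \<and> blinfun_apply \<psi> z = 1)"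

end

theory Submission
  imports Defs
begin

text \<open>Failure of (i) means that some half-space \<open>{\<phi> \<ge> s}\<close> with \<open>\<phi> x < s\<close> meets every slice
  \<open>{f > 1 - d}\<close> of the unit ball. Cutting the ball with this half-space violates (ii), and a
  functional \<open>\<psi>\<close> of norm at most 1 on the dual with \<open>\<psi> f \<ge> 1\<close> and \<open>\<psi> \<phi> \<ge> s\<close> violates (iii);
  the latter comes from the Mazur--Orlicz form of the Hahn--Banach theorem, so no weak-star
  compactness is needed. Conversely, (i) implies (ii) because closed convex sets are weakly closed,
  and (i) implies (iii) because Helly's lemma realises \<open>(\<psi> f, \<psi> \<phi>)\<close> as a limit of
  \<open>(f u, \<phi> u)\<close> with \<open>u\<close> in the unit ball.

  Mazur--Orlicz itself is proved through minimal sublinear functionals: Zorn's lemma yields one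
  below any given sublinear functional, and minimality forces it to be odd, hence linear.\<close>

section \<open>Sublinear functionals and their infima\<close>

definition sublinear :: "('a::real_vector \<Rightarrow> real) \<Rightarrow> bool" where
  "sublinear p \<longleftrightarrow> (\<forall>x y. p (x + y) \<le> p x + p y) \<and> (\<forall>t\<ge>0. \<forall>x. p (t *\<^sub>R x) = t * p x)"

text \<open>The factor \<open>1 / t\<close> reverses the scaling inequality, so one direction for
  positive factors is enough; this is the form in which infima deliver homogeneity.\<close>

lemma sublinearI:
  assumes add: "\<And>x y. p (x + y) \<le> p x + p y"
    and scale: "\<And>t x. t > 0 \<Longrightarrow> p (t *\<^sub>R x) \<le> t * p x"
  shows "sublinear p"
proof -
  have "p (t *\<^sub>R x) = t * p x" if "t \<ge> 0" for t x
  proof (cases "t = 0")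
    case True
    \<comment> \<open>The factor 2 gives \<open>p 0 \<ge> 0\<close>, the factor 1/2 gives
      \<open>p 0 \<le> 0\<close>.\<close>
    have "p 0 = 0"
      using scale[of 2 0] scale[of "1/2" 0] by simp
    with True show ?thesis by simp
  next
    case False
    with that have "t > 0" by simp
    with scale[of "1 / t" "t *\<^sub>R x"] have "t * p x \<le> p (t *\<^sub>R x)"
      by (simp add: field_simps)
    with scale[OF \<open>t > 0\<close>, of x] show ?thesis by simp
  qed
  with add show ?thesis by (simp add: sublinear_def)
qed

lemma sublinear_add: "sublinear p \<Longrightarrow> p (x + y) \<le> p x + p y"
  by (simp add: sublinear_def)

lemma sublinear_scale: "sublinear p \<Longrightarrow> t \<ge> 0 \<Longrightarrow> p (t *\<^sub>R x) = t * p x"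
  by (simp add: sublinear_def)

lemma sublinear_zero: "sublinear p \<Longrightarrow> p 0 = 0"
  using sublinear_scale[of p 0 0] by simp

lemma sublinear_minus_ge: "sublinear p \<Longrightarrow> - p (- x) \<le> p x"
  using sublinear_add[of p x "- x"] sublinear_zero[of p] by simp

lemma sublinear_norm: "sublinear norm"
  by (simp add: sublinear_def norm_triangle_ineq)

text \<open>The individual \<open>F i\<close> may fail to be sublinear; it is enough that the family
  absorbs sums and positive multiples through another index \<open>k\<close>. This covers both later
  uses: a cone as index set, where indices are added and scaled, and a chain of functionals, where
  \<open>k\<close> is the smaller of two.\<close>

lemma sublinear_INF:
  fixes F :: "'i \<Rightarrow> 'a::real_vector \<Rightarrow> real"
  assumes ne: "I \<noteq> {}"
    and bdd: "\<And>x. bdd_below ((\<lambda>i. F i x) ` I)"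
    and add: "\<And>i j x y. i \<in> I \<Longrightarrow> j \<in> I \<Longrightarrow> \<exists>k\<in>I. F k (x + y) \<le> F i x + F j y"
    and scale: "\<And>i t x. i \<in> I \<Longrightarrow> t > 0 \<Longrightarrow> \<exists>k\<in>I. F k (t *\<^sub>R x) \<le> t * F i x"
  shows "sublinear (\<lambda>x. INF i\<in>I. F i x)"
proof (rule sublinearI)
  let ?q = "\<lambda>x. INF i\<in>I. F i x"
  have low: "?q x \<le> F k x" if "k \<in> I" for k x
    using bdd that by (rule cINF_lower)
  show "?q (x + y) \<le> ?q x + ?q y" for x y
  proof -
    have *: "?q (x + y) \<le> F i x + F j y" if "i \<in> I" "j \<in> I" for i j
      using add[OF that, of x y] low order_trans by blast
    \<comment> \<open>The infimum over \<open>i\<close> is taken with \<open>j\<close> fixed, then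
      the one over \<open>j\<close>.\<close>
    have "?q (x + y) - F j y \<le> ?q x" if "j \<in> I" for j
      using ne * that by (intro cINF_greatest) (auto simp: algebra_simps)
    then have "?q (x + y) - ?q x \<le> ?q y"
      using ne by (intro cINF_greatest) (auto simp: algebra_simps)
    then show ?thesis by simp
  qed
  show "?q (t *\<^sub>R x) \<le> t * ?q x" if "t > 0" for t x
  proof -
    have "?q (t *\<^sub>R x) / t \<le> F i x" if "i \<in> I" for i
      using scale[OF that \<open>t > 0\<close>, of x] low order_trans \<open>t > 0\<close>
      by (fastforce simp: field_simps)
    then have "?q (t *\<^sub>R x) / t \<le> ?q x"
      using ne by (intro cINF_greatest) auto
    with \<open>t > 0\<close> show ?thesis by (simp add: field_simps)
  qed
qed

text \<open>The witness is \<open>q x = inf (p (x + c) - b)\<close> over \<open>(c, b)\<close> in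
  \<open>K\<close>: the vertex 0 gives \<open>q \<le> p\<close>, and the pair \<open>(c, b)\<close>
  itself bounds \<open>q (- c)\<close>. The bound is placed at \<open>- c\<close> because a linear
  \<open>g \<le> q\<close> then satisfies \<open>b \<le> g c\<close>.\<close>

lemma sublinear_minorant_cone:
  fixes p :: "'a::real_vector \<Rightarrow> real"
  assumes p: "sublinear p" and K: "convex_cone K" and le: "\<And>c b. (c, b) \<in> K \<Longrightarrow> b \<le> p c"
  obtains q where "sublinear q" "q \<le> p" "\<And>c b. (c, b) \<in> K \<Longrightarrow> q (- c) \<le> - b"
proof
  define F where "F = (\<lambda>z x. p (x + fst z) - snd z)"
  let ?q = "\<lambda>x. INF z\<in>K. F z x"
  \<comment> \<open>From \<open>b \<le> p c \<le> p (x + c) + p (- x)\<close>; the bound does not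
    depend on \<open>z\<close>, so the infimum is finite.\<close>
  have F_ge: "- p (- x) \<le> F z x" if "z \<in> K" for z x
    using le[of "fst z" "snd z"] sublinear_add[OF p, of "x + fst z" "- x"] that
    by (simp add: F_def)
  then have bdd: "bdd_below ((\<lambda>z. F z x) ` K)" for x
    by (intro bdd_belowI2)
  have low: "?q x \<le> F z x" if "z \<in> K" for z x
    using bdd that by (rule cINF_lower)
  show "sublinear ?q"
  proof (rule sublinear_INF)
    show "K \<noteq> {}" using K by (rule convex_cone_nonempty)
    show "bdd_below ((\<lambda>z. F z x) ` K)" for x by (rule bdd)
    show "\<exists>k\<in>K. F k (x + y) \<le> F i x + F j y" if "i \<in> K" "j \<in> K" for i j x y
    proof
      show "i + j \<in> K" using K that by (rule convex_cone_add)
      show "F (i + j) (x + y) \<le> F i x + F j y"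
        using sublinear_add[OF p, of "x + fst i" "y + fst j"]
        by (simp add: F_def algebra_simps)
    qed
    show "\<exists>k\<in>K. F k (t *\<^sub>R x) \<le> t * F i x" if "i \<in> K" "t > 0" for i t x
    proof
      show "t *\<^sub>R i \<in> K" using K that by (simp add: convex_cone_scaleR)
      show "F (t *\<^sub>R i) (t *\<^sub>R x) \<le> t * F i x"
        using sublinear_scale[OF p, of t "x + fst i"] \<open>t > 0\<close>
        by (simp add: F_def algebra_simps)
    qed
  qed
  show "?q \<le> p"
    using low[OF convex_cone_contains_0[OF K]] by (simp add: le_fun_def F_def)
  show "?q (- c) \<le> - b" if "(c, b) \<in> K" for c b
    using low[OF that, of "- c"] sublinear_zero[OF p] by (simp add: F_def)
qed

section \<open>Minimal sublinear functionals and their linearity\<close>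

lemma sublinear_minimal_exists:
  fixes p :: "'a::real_vector \<Rightarrow> real"
  assumes p: "sublinear p"
  obtains m where "sublinear m" "m \<le> p" "\<And>q. sublinear q \<Longrightarrow> q \<le> m \<Longrightarrow> q = m"
proof -
  define A where "A = {q. sublinear q \<and> q \<le> p}"
  \<comment> \<open>Zorn's lemma for the reversed order: maximal elements are minimal functionals,
    and the bound of a nonempty chain is its pointwise infimum.\<close>
  have "\<exists>m\<in>A. \<forall>q\<in>A. m \<ge> q \<longrightarrow> q = m"
  proof (rule predicate_Zorn)
    show "partial_order_on A (relation_of (\<ge>) A)"
      by (rule partial_order_on_relation_ofI) auto
  next
    fix C assume "C \<in> Chains (relation_of (\<ge>) A)"
    then have CA: "C \<subseteq> A" and tot: "\<And>q r. q \<in> C \<Longrightarrow> r \<in> C \<Longrightarrow> q \<le> r \<or> r \<le> q"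
      by (auto simp: Chains_def relation_of_def)
    show "\<exists>u\<in>A. \<forall>q\<in>C. q \<ge> u"
    \<comment> \<open>An infimum over the empty chain would be an unspecified real; \<open>p\<close>
      itself bounds that chain.\<close>
    proof (cases "C = {}")
      case True
      then show ?thesis using p by (auto simp: A_def)
    next
      case False
      let ?u = "\<lambda>x. INF q\<in>C. q x"
      \<comment> \<open>Every \<open>q\<close> in the chain satisfies
        \<open>- p (- x) \<le> - q (- x) \<le> q x\<close>, which keeps the infimum finite.\<close>
      have "- p (- x) \<le> q x" if "q \<in> C" for q x
      proof -
        from that CA have "sublinear q" "q (- x) \<le> p (- x)" by (auto simp: A_def le_fun_def)
        with sublinear_minus_ge[of q x] show ?thesis by simp
      qed
      then have bdd: "bdd_below ((\<lambda>q. q x) ` C)" for x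
        by (intro bdd_belowI2)
      have low: "?u x \<le> q x" if "q \<in> C" for q x
        using bdd that by (rule cINF_lower)
      have "sublinear ?u"
      proof (rule sublinear_INF[OF False bdd])
        fix q r x y assume qr: "q \<in> C" "r \<in> C"
        then obtain s where s: "s \<in> C" "s \<le> q" "s \<le> r" using tot by blast
        with CA have "s (x + y) \<le> s x + s y" by (auto simp: A_def sublinear_def)
        also have "\<dots> \<le> q x + r y" using s by (simp add: le_fun_def add_mono)
        finally show "\<exists>s\<in>C. s (x + y) \<le> q x + r y" using s by blast
      next
        fix q x and t :: real assume "q \<in> C" "t > 0"
        then show "\<exists>s\<in>C. s (t *\<^sub>R x) \<le> t * q x"
          using CA by (intro bexI[of _ q]) (auto simp: A_def sublinear_scale)
      qed
      moreover have "?u \<le> p"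
      proof -
        obtain q where "q \<in> C" using False by blast
        then have "?u \<le> q" "q \<le> p" using low CA by (auto simp: A_def le_fun_def)
        then show ?thesis by (rule order_trans)
      qed
      ultimately show ?thesis using low by (auto simp: A_def le_fun_def)
    qed
  qed
  then obtain m where m: "m \<in> A" "\<And>q. q \<in> A \<Longrightarrow> q \<le> m \<Longrightarrow> q = m" by blast
  show thesis
  proof
    show "sublinear m" "m \<le> p" using m(1) by (auto simp: A_def)
    show "q = m" if "sublinear q" "q \<le> m" for q
      using m that by (auto simp: A_def intro: order_trans)
  qed
qed

text \<open>Apply the cone construction to the ray through \<open>(y, m y)\<close>: by minimality
  the minorant is \<open>m\<close> again, so its bound reads \<open>m (- y) \<le> - m y\<close>. The
  reverse inequality holds for every sublinear functional, hence \<open>m\<close> is odd.\<close>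

lemma minimal_sublinear_imp_linear:
  fixes m :: "'a::real_vector \<Rightarrow> real"
  assumes m: "sublinear m" and min: "\<And>q. sublinear q \<Longrightarrow> q \<le> m \<Longrightarrow> q = m"
  shows "linear m"
proof -
  have odd: "m (- y) = - m y" for y
  proof -
    define K where "K = (\<lambda>t. t *\<^sub>R (y, m y)) ` {0..}"
    have "convex_cone K"
      unfolding convex_cone_iff
    proof (intro conjI ballI allI impI)
      show "0 \<in> K" by (auto simp: K_def zero_prod_def intro!: image_eqI[of _ _ 0])
      show "z + w \<in> K" if "z \<in> K" "w \<in> K" for z w
      proof -
        from that obtain a b where "a \<ge> 0" "b \<ge> 0" "z = a *\<^sub>R (y, m y)" "w = b *\<^sub>R (y, m y)"
          unfolding K_def by blast
        then show ?thesis
          unfolding K_def by (intro image_eqI[of _ _ "a + b"]) (auto simp: algebra_simps)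
      qed
      show "c *\<^sub>R z \<in> K" if "z \<in> K" "c \<ge> 0" for z c
      proof -
        from that obtain a where "a \<ge> 0" "z = a *\<^sub>R (y, m y)"
          unfolding K_def by blast
        with that show ?thesis
          unfolding K_def by (intro image_eqI[of _ _ "c * a"]) auto
      qed
    qed
    moreover have "b \<le> m c" if "(c, b) \<in> K" for c b
      using that by (auto simp: K_def sublinear_scale[OF m])
    ultimately obtain q where q: "sublinear q" "q \<le> m" "\<And>c b. (c, b) \<in> K \<Longrightarrow> q (- c) \<le> - b"
      using sublinear_minorant_cone[OF m] by blast
    have "(y, m y) \<in> K" by (auto simp: K_def intro!: image_eqI[of _ _ 1])
    with q min have "m (- y) \<le> - m y" by blast
    with sublinear_minus_ge[OF m, of y] show ?thesis by simp
  qed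
  show ?thesis
  proof (rule linearI)
    \<comment> \<open>By oddness, subadditivity at \<open>- x\<close> and \<open>- y\<close> is
      superadditivity at \<open>x\<close> and \<open>y\<close>.\<close>
    show "m (x + y) = m x + m y" for x y
      using sublinear_add[OF m, of x y] sublinear_add[OF m, of "- x" "- y"] odd[of "x + y"]
        odd[of x] odd[of y] by simp
    show "m (t *\<^sub>R x) = t *\<^sub>R m x" for t x
    proof (cases "t \<ge> 0")
      case True
      then show ?thesis by (simp add: sublinear_scale[OF m])
    next
      case False
      then show ?thesis
        using sublinear_scale[OF m, of "- t" x] odd[of "t *\<^sub>R x"] by simp
    qed
  qed
qed

section \<open>The Mazur--Orlicz theorem and separation from closed convex sets\<close>

theorem Mazur_Orlicz:
  fixes p :: "'a::real_vector \<Rightarrow> real"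
  assumes p: "sublinear p" and C: "convex C" and le: "\<And>c b. (c, b) \<in> C \<Longrightarrow> b \<le> p c"
  obtains g where "linear g" "g \<le> p" "\<And>c b. (c, b) \<in> C \<Longrightarrow> b \<le> g c"
proof -
  let ?K = "convex_cone hull C"
  \<comment> \<open>For convex \<open>C\<close> the conic hull consists of 0 and the nonnegative
    multiples of points of \<open>C\<close>, so homogeneity of \<open>p\<close> carries the bound
    over.\<close>
  have "b \<le> p c" if "(c, b) \<in> ?K" for c b
    using that le C unfolding convex_cone_hull_convex_hull
    by (auto simp: zero_prod_def hull_same sublinear_zero[OF p] sublinear_scale[OF p] mult_left_mono)
  then obtain q where q: "sublinear q" "q \<le> p" "\<And>c b. (c, b) \<in> ?K \<Longrightarrow> q (- c) \<le> - b"
    using sublinear_minorant_cone[OF p convex_cone_convex_cone_hull] by metis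
  obtain g where g: "sublinear g" "g \<le> q" "\<And>r. sublinear r \<Longrightarrow> r \<le> g \<Longrightarrow> r = g"
    using sublinear_minimal_exists[OF q(1)] by metis
  show thesis
  proof
    show lin: "linear g" using g(1,3) by (rule minimal_sublinear_imp_linear)
    show "g \<le> p" using g q by order
    show "b \<le> g c" if "(c, b) \<in> C" for c b
    proof -
      have "g (- c) \<le> q (- c)" using g by (simp add: le_fun_def)
      also have "\<dots> \<le> - b" using that by (intro q hull_inc)
      finally show ?thesis by (simp add: linear_neg[OF lin])
    qed
  qed
qed

text \<open>A pair \<open>(c, b)\<close> is a demand that the value at \<open>c\<close> be at least
  \<open>b\<close>; lying below the norm amounts to having norm at most 1. It serves once on the
  given space, for separation, and once on the dual, to produce an element of the bidual.\<close>

corollary Mazur_Orlicz_norm: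
  fixes C :: "('a::real_normed_vector \<times> real) set"
  assumes C: "convex C" and le: "\<And>c b. (c, b) \<in> C \<Longrightarrow> b \<le> norm c"
  obtains \<psi> :: "'a \<Rightarrow>\<^sub>L real"
  where "norm \<psi> \<le> 1" "\<And>c b. (c, b) \<in> C \<Longrightarrow> b \<le> blinfun_apply \<psi> c"
proof -
  obtain g where g: "linear g" "g \<le> norm" "\<And>c b. (c, b) \<in> C \<Longrightarrow> b \<le> g c"
    using Mazur_Orlicz[OF sublinear_norm C le] by metis
  have bound: "norm (g y) \<le> 1 * norm y" for y
    using g(2) linear_neg[OF g(1), of y] le_funD[OF g(2), of y] le_funD[OF g(2), of "- y"] by simp
  then have "bounded_linear g"
    using g(1) by (auto simp: bounded_linear_def bounded_linear_axioms_def linear_conv_bounded_linear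
        intro!: exI[of _ 1])
  then have app: "blinfun_apply (Blinfun g) = g" by (rule bounded_linear_Blinfun_apply)
  show thesis
  proof
    show "norm (Blinfun g) \<le> 1" using bound by (intro norm_blinfun_bound) (auto simp: app)
    show "b \<le> blinfun_apply (Blinfun g) c" if "(c, b) \<in> C" for c b
      using g that by (simp add: app)
  qed
qed

text \<open>A ball of radius \<open>e\<close> about \<open>x\<close> misses \<open>C\<close>, so the
  vectors \<open>y - x\<close> have norm at least \<open>e\<close>, and the demands
  \<open>(y - x, e)\<close> can be met by one functional.\<close>

lemma separating_functional_closed_convex_point:
  fixes C :: "'a::real_normed_vector set"
  assumes C: "closed C" "convex C" and x: "x \<notin> C"
  obtains \<phi> :: "'a \<Rightarrow>\<^sub>L real" and e where "e > 0" "\<And>y. y \<in> C \<Longrightarrow> \<phi> x + e \<le> \<phi> y"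
proof -
  obtain e where e: "e > 0" "\<And>y. y \<in> C \<Longrightarrow> e \<le> norm (y - x)"
  proof -
    from C(1) x obtain e where "e > 0" "ball x e \<subseteq> - C"
      using open_contains_ball[of "- C"] by auto
    then show thesis
      by (intro that[of e]) (auto simp: subset_iff dist_norm norm_minus_commute not_less[symmetric])
  qed
  let ?D = "(\<lambda>y. y - x) ` C \<times> {e}"
  have conv: "convex ?D" using C by (intro convex_Times convex_translation_subtract) auto
  have le: "b \<le> norm c" if "(c, b) \<in> ?D" for c b
    using that e(2) by auto
  obtain \<phi> :: "'a \<Rightarrow>\<^sub>L real" where \<phi>: "\<And>c b. (c, b) \<in> ?D \<Longrightarrow> b \<le> \<phi> c"
    using Mazur_Orlicz_norm[OF conv le] by metis
  show thesis
  proof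
    show "e > 0" by fact
    show "\<phi> x + e \<le> \<phi> y" if "y \<in> C" for y
      using \<phi>[of "y - x" e] that by (auto simp: blinfun.diff_right)
  qed
qed

text \<open>The gap \<open>e\<close> left by a separating functional would survive in the limit of
  \<open>\<phi> (u n)\<close>.\<close>

lemma closed_convex_limitin_weak_topology:
  fixes C :: "'a::real_normed_vector set"
  assumes "closed C" "convex C" "\<And>n. u n \<in> C" "limitin weak_topology u x sequentially"
  shows "x \<in> C"
proof (rule ccontr)
  assume "x \<notin> C"
  with assms(1,2) obtain \<phi> :: "'a \<Rightarrow>\<^sub>L real" and e
    where e: "e > 0" "\<And>y. y \<in> C \<Longrightarrow> \<phi> x + e \<le> \<phi> y"
    by (rule separating_functional_closed_convex_point) blast
  have "(\<lambda>n. \<phi> (u n)) \<longlonglongrightarrow> \<phi> x"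
    using assms(4) by (simp add: limitin_weak_topology)
  then have "\<phi> x + e \<le> \<phi> x"
    using e(2) assms(3) by (intro Lim_bounded2) auto
  with e(1) show False by simp
qed

section \<open>Functionals on the dual: evaluations and Helly's lemma\<close>

lemma blinfun_le_norm:
  fixes f :: "'a::real_normed_vector \<Rightarrow>\<^sub>L real"
  assumes "norm y \<le> 1"
  shows "f y \<le> norm f"
proof -
  have "f y \<le> norm f * norm y" using norm_blinfun[of f y] by simp
  also have "\<dots> \<le> norm f" using assms by (simp add: mult_left_le)
  finally show ?thesis .
qed

text \<open>This is the canonical image of \<open>x\<close> in the bidual; its norm is attained at
  \<open>f\<close>. It is the functional with which every competitor in (iii) is compared.\<close>

lemma norming_evaluation:
  fixes f :: "'a::real_normed_vector \<Rightarrow>\<^sub>L real"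
  assumes f: "norm f = 1" and x: "norm x = 1" and fx: "f x = 1"
  obtains J :: "('a \<Rightarrow>\<^sub>L real) \<Rightarrow>\<^sub>L real" where "norm J = 1" "\<And>\<phi>. J \<phi> = \<phi> x"
proof -
  let ?J = "Blinfun (\<lambda>\<phi> :: 'a \<Rightarrow>\<^sub>L real. blinfun_apply \<phi> x)"
  have J: "blinfun_apply ?J = (\<lambda>\<phi>. blinfun_apply \<phi> x)"
    by (rule bounded_linear_Blinfun_apply) (rule blinfun.bounded_linear_left)
  have "norm (\<phi> x) \<le> 1 * norm \<phi>" for \<phi> :: "'a \<Rightarrow>\<^sub>L real"
    using norm_blinfun[of \<phi> x] x by simp
  then have "norm ?J = 1"
    by (intro norm_blinfun_eqI[where x = f]) (simp_all only: J f fx, simp_all)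
  then show thesis using that[of ?J] by (simp add: J)
qed

text \<open>Helly's lemma for two functionals: a separating line in the plane would give a linear
  combination of \<open>f\<close> and \<open>\<phi>\<close> whose value under \<open>\<psi>\<close> exceeds its norm.\<close>

lemma Helly_two_functionals:
  fixes f \<phi> :: "'a::real_normed_vector \<Rightarrow>\<^sub>L real" and \<psi> :: "('a \<Rightarrow>\<^sub>L real) \<Rightarrow>\<^sub>L real"
  assumes "norm \<psi> \<le> 1"
  shows "(\<psi> f, \<psi> \<phi>) \<in> closure ((\<lambda>y. (f y, \<phi> y)) ` cball 0 1)"
proof (rule ccontr)
  let ?S = "(\<lambda>y. (f y, \<phi> y)) ` cball 0 1"
  assume "(\<psi> f, \<psi> \<phi>) \<notin> closure ?S"
  moreover have "linear (\<lambda>y. (f y, \<phi> y))"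
    by (rule linearI) (auto simp: blinfun.bilinear_simps)
  then have "convex (closure ?S)"
    by (intro convex_closure convex_linear_image) auto
  ultimately obtain w b where w: "w \<bullet> (\<psi> f, \<psi> \<phi>) < b" "\<And>z. z \<in> closure ?S \<Longrightarrow> b < w \<bullet> z"
    using separating_hyperplane_closed_point[OF _ closed_closure] by blast
  \<comment> \<open>The image of the ball lies above the level \<open>b\<close>; the sign change
    turns this into the upper bound \<open>- b\<close> for \<open>h\<close> on the ball.\<close>
  define h where "h = - (fst w *\<^sub>R f + snd w *\<^sub>R \<phi>)"
  have h_less: "h y < - b" if "norm y \<le> 1" for y
  proof -
    have "(f y, \<phi> y) \<in> closure ?S"
      using that closure_subset[of ?S] by auto
    from w(2)[OF this] show ?thesis
      by (simp add: h_def inner_prod_def blinfun.bilinear_simps)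
  qed
  from h_less[of 0] have b: "0 < - b" by (simp add: blinfun.zero_right)
  have "norm h \<le> - b"
  proof (rule norm_blinfun_bound)
    show "norm (h y) \<le> - b * norm y" for y
    proof (cases "y = 0")
      case False
      \<comment> \<open>The ball is symmetric, so the one-sided bound at both signs of the
        normalised vector bounds the absolute value.\<close>
      then have "h (y /\<^sub>R norm y) < - b" "h (- (y /\<^sub>R norm y)) < - b"
        by (intro h_less; simp)+
      with False show ?thesis
        by (simp add: blinfun.bilinear_simps field_simps)
    qed (simp add: blinfun.zero_right)
  qed (use b in simp)
  moreover have "- b < \<psi> h"
    using w(1) by (simp add: h_def inner_prod_def blinfun.bilinear_simps)
  moreover have "\<psi> h \<le> norm h"
    using norm_blinfun[of \<psi> h] mult_right_mono[OF assms norm_ge_zero[of h]] by simp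
  ultimately show False by simp
qed

lemma Helly_sequence:
  fixes f \<phi> :: "'a::real_normed_vector \<Rightarrow>\<^sub>L real" and \<psi> :: "('a \<Rightarrow>\<^sub>L real) \<Rightarrow>\<^sub>L real"
  assumes "norm \<psi> \<le> 1"
  obtains u where "\<And>n. u n \<in> cball 0 1" "(\<lambda>n. f (u n)) \<longlonglongrightarrow> \<psi> f" "(\<lambda>n. \<phi> (u n)) \<longlonglongrightarrow> \<psi> \<phi>"
proof -
  obtain z where z: "\<And>n. z n \<in> (\<lambda>y. (f y, \<phi> y)) ` cball 0 1" "z \<longlonglongrightarrow> (\<psi> f, \<psi> \<phi>)"
    using Helly_two_functionals[OF assms, of f \<phi>] unfolding closure_sequential by blast
  then obtain u where u: "\<And>n. u n \<in> cball 0 1" "z = (\<lambda>n. (f (u n), \<phi> (u n)))"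
    unfolding image_iff by metis
  show thesis
    using that[of u] u tendsto_fst[OF z(2)] tendsto_snd[OF z(2)] by simp
qed

section \<open>Equivalence of the three conditions\<close>

lemma not_weakly_exposesE:
  fixes f :: "'a::real_normed_vector \<Rightarrow>\<^sub>L real"
  assumes "\<not> weakly_exposes f x" "f \<in> sphere 0 1" "x \<in> sphere 0 1"
  obtains \<phi> :: "'a \<Rightarrow>\<^sub>L real" and s where "blinfun_apply \<phi> x < s"
    "\<And>d. d > 0 \<Longrightarrow> \<exists>y\<in>cball 0 1. 1 - d < blinfun_apply f y \<and> s \<le> blinfun_apply \<phi> y"
proof -
  obtain u where u: "\<And>n. u n \<in> cball 0 1" "(\<lambda>n. blinfun_apply f (u n)) \<longlonglongrightarrow> 1"
    and "\<not> limitin weak_topology u x sequentially"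
    using assms unfolding weakly_exposes_def by blast
  then obtain \<phi> :: "'a \<Rightarrow>\<^sub>L real" where "\<not> (\<lambda>n. blinfun_apply \<phi> (u n)) \<longlonglongrightarrow> blinfun_apply \<phi> x"
    by (auto simp: limitin_weak_topology)
  then obtain e where e: "e > 0" "\<exists>\<^sub>F n in sequentially. e \<le> dist (\<phi> (u n)) (\<phi> x)"
    by (auto simp: tendsto_iff not_eventually not_less)
  \<comment> \<open>The distance is two-sided, a half-space is not. One of the two alternatives
    occurs infinitely often, and \<open>\<theta>\<close> is \<open>\<phi>\<close> or
    \<open>- \<phi>\<close> accordingly; since \<open>f (u n)\<close> tends to 1, that half-space
    meets every slice.\<close>
  have "\<exists>\<^sub>F n in sequentially. \<phi> x + e \<le> \<phi> (u n) \<or> (- \<phi>) x + e \<le> (- \<phi>) (u n)"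
    using e(2) by (rule frequently_mono[rotated]) (auto simp: dist_real_def blinfun.minus_left)
  then obtain \<theta> :: "'a \<Rightarrow>\<^sub>L real" where \<theta>: "\<exists>\<^sub>F n in sequentially. blinfun_apply \<theta> x + e \<le> blinfun_apply \<theta> (u n)"
    unfolding frequently_disj_iff by blast
  show thesis
  proof
    show "\<theta> x < \<theta> x + e" using e by simp
    fix d :: real assume "d > 0"
    then have "\<forall>\<^sub>F n in sequentially. 1 - d < f (u n)"
      using order_tendstoD(1)[OF u(2), of "1 - d"] by simp
    with \<theta> have "\<exists>\<^sub>F n in sequentially. \<theta> x + e \<le> \<theta> (u n) \<and> 1 - d < f (u n)"
      by (auto elim: frequently_rev_mp eventually_mono)
    then obtain n where "1 - d < f (u n) \<and> \<theta> x + e \<le> \<theta> (u n)"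
      using frequently_ex by blast
    with u(1) show "\<exists>y\<in>cball 0 1. 1 - d < f y \<and> \<theta> x + e \<le> \<theta> y" by blast
  qed
qed

lemma weakly_exposes_imp_mem:
  fixes f :: "'a::real_normed_vector \<Rightarrow>\<^sub>L real"
  assumes wexp: "weakly_exposes f x"
    and C: "closed C" "convex C" "C \<subseteq> cball 0 1" "C \<noteq> {}" and sup: "(SUP y\<in>C. f y) = 1"
  shows "x \<in> C"
proof -
  have f: "norm f = 1" using wexp by (simp add: weakly_exposes_def)
  have f_le: "f y \<le> 1" if "y \<in> C" for y
    using that C(3) blinfun_le_norm[of y f] f by auto
  then have bdd: "bdd_above (blinfun_apply f ` C)" by (intro bdd_aboveI2)
  \<comment> \<open>As \<open>C\<close> is nonempty and \<open>f\<close> is bounded above on it, the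
    real supremum is a genuine one, and a maximising sequence can be chosen in
    \<open>C\<close>.\<close>
  have "\<exists>y\<in>C. 1 - 1 / real (Suc n) < f y" for n
    using less_cSUP_iff[OF C(4) bdd, of "1 - 1 / real (Suc n)"] sup by simp
  then obtain u where u: "\<And>n. u n \<in> C" "\<And>n. 1 - 1 / real (Suc n) < f (u n)" by metis
  have "(\<lambda>n. f (u n)) \<longlonglongrightarrow> 1"
  proof (rule tendsto_sandwich)
    show "(\<lambda>n. 1 - 1 / real (Suc n)) \<longlonglongrightarrow> 1"
      using tendsto_diff[OF tendsto_const LIMSEQ_inverse_real_of_nat, of 1]
      by (simp add: inverse_eq_divide)
    show "\<forall>\<^sub>F n in sequentially. 1 - 1 / real (Suc n) \<le> f (u n)"
      using u(2) by (intro always_eventually allI less_imp_le)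
    show "\<forall>\<^sub>F n in sequentially. f (u n) \<le> 1"
      using u(1) f_le by simp
  qed simp
  with wexp u(1) C(3) have "limitin weak_topology u x sequentially"
    unfolding weakly_exposes_def by blast
  with C(1,2) u(1) show ?thesis by (rule closed_convex_limitin_weak_topology)
qed

lemma mem_imp_weakly_exposes:
  fixes f :: "'a::real_normed_vector \<Rightarrow>\<^sub>L real"
  assumes f: "f \<in> sphere 0 1" and x: "x \<in> sphere 0 1"
    and mem: "\<And>C. \<lbrakk>closed C; convex C; C \<subseteq> cball 0 1; C \<noteq> {}; (SUP y\<in>C. f y) = 1\<rbrakk> \<Longrightarrow> x \<in> C"
  shows "weakly_exposes f x"
proof (rule ccontr)
  assume "\<not> weakly_exposes f x"
  then obtain \<phi> :: "'a \<Rightarrow>\<^sub>L real" and s where \<phi>: "blinfun_apply \<phi> x < s"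
    and slice: "\<And>d. d > 0 \<Longrightarrow> \<exists>y\<in>cball 0 1. 1 - d < f y \<and> s \<le> blinfun_apply \<phi> y"
    using f x by (rule not_weakly_exposesE) blast
  \<comment> \<open>The half-space cuts \<open>x\<close> off, yet it meets every slice, so the
    supremum of \<open>f\<close> remains 1.\<close>
  let ?C = "cball 0 1 \<inter> {y. s \<le> \<phi> y}"
  have "x \<in> ?C"
  proof (rule mem)
    show "closed ?C"
      by (intro closed_Int closed_cball closed_Collect_le continuous_intros)
    have "{y. s \<le> \<phi> y} = blinfun_apply \<phi> -` {s..}" by auto
    then show "convex ?C"
      by (auto intro!: convex_Int convex_linear_vimage bounded_linear.linear blinfun.bounded_linear_right)
    show ne: "?C \<noteq> {}" using slice[of 1] by auto
    have f_le: "f y \<le> 1" if "y \<in> ?C" for y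
      using that blinfun_le_norm[of y f] f by auto
    show "(SUP y\<in>?C. f y) = 1"
    proof (rule antisym)
      show "(SUP y\<in>?C. f y) \<le> 1" using ne f_le by (rule cSUP_least)
      show "1 \<le> (SUP y\<in>?C. f y)"
      proof (rule field_le_epsilon)
        fix d :: real assume "d > 0"
        then obtain y where y: "y \<in> ?C" "1 - d < f y" using slice[of d] by auto
        have "f y \<le> (SUP y\<in>?C. f y)"
          using f_le by (intro cSUP_upper y bdd_aboveI2)
        with y show "1 \<le> (SUP y\<in>?C. f y) + d" by simp
      qed
    qed
  qed auto
  with \<phi> show False by simp
qed

lemma weakly_exposes_imp_G_smooth_point:
  fixes f :: "'a::real_normed_vector \<Rightarrow>\<^sub>L real"
  assumes wexp: "weakly_exposes f x" and fx: "f x = 1"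
  shows "G_smooth_point f"
  unfolding G_smooth_point_def
proof (rule ex_ex1I)
  have f: "norm f = 1" and x: "norm x = 1" using wexp by (auto simp: weakly_exposes_def)
  then obtain J :: "('a \<Rightarrow>\<^sub>L real) \<Rightarrow>\<^sub>L real" where "norm J = 1" "\<And>\<phi>. J \<phi> = \<phi> x"
    using norming_evaluation fx by blast
  with fx show "\<exists>\<psi> :: ('a \<Rightarrow>\<^sub>L real) \<Rightarrow>\<^sub>L real. \<psi> \<in> sphere 0 1 \<and> blinfun_apply \<psi> f = 1"
    by (intro exI[of _ J]) simp
next
  have eval: "blinfun_apply \<psi> \<phi> = blinfun_apply \<phi> x" if \<psi>: "\<psi> \<in> sphere 0 1 \<and> blinfun_apply \<psi> f = 1" for \<psi> :: "('a \<Rightarrow>\<^sub>L real) \<Rightarrow>\<^sub>L real" and \<phi>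
  proof -
    \<comment> \<open>The sequence depends on \<open>\<phi>\<close>, but \<open>f (u n)\<close>
      tends to \<open>\<psi> f = 1\<close>, so its weak limit is \<open>x\<close> for every
      \<open>\<phi>\<close>.\<close>
    obtain u where u: "\<And>n. u n \<in> cball 0 1" "(\<lambda>n. f (u n)) \<longlonglongrightarrow> \<psi> f" "(\<lambda>n. \<phi> (u n)) \<longlonglongrightarrow> \<psi> \<phi>"
      using Helly_sequence[of \<psi> f \<phi>] \<psi> by auto
    with wexp \<psi> have "limitin weak_topology u x sequentially"
      unfolding weakly_exposes_def by simp
    then have "(\<lambda>n. \<phi> (u n)) \<longlonglongrightarrow> \<phi> x" by (simp add: limitin_weak_topology)
    with u(3) show ?thesis by (rule LIMSEQ_unique)
  qed
  show "\<psi> = \<psi>'" if "\<psi> \<in> sphere 0 1 \<and> blinfun_apply \<psi> f = 1" "\<psi>' \<in> sphere 0 1 \<and> blinfun_apply \<psi>' f = 1"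
    for \<psi> \<psi>' :: "('a \<Rightarrow>\<^sub>L real) \<Rightarrow>\<^sub>L real"
    using eval[OF that(1)] eval[OF that(2)] by (intro blinfun_eqI) simp
qed

lemma G_smooth_point_imp_weakly_exposes:
  fixes f :: "'a::real_normed_vector \<Rightarrow>\<^sub>L real"
  assumes f: "f \<in> sphere 0 1" and x: "x \<in> sphere 0 1" and fx: "f x = 1" and G: "G_smooth_point f"
  shows "weakly_exposes f x"
proof (rule ccontr)
  assume "\<not> weakly_exposes f x"
  then obtain \<phi> :: "'a \<Rightarrow>\<^sub>L real" and s where \<phi>: "blinfun_apply \<phi> x < s"
    and slice: "\<And>d. d > 0 \<Longrightarrow> \<exists>y\<in>cball 0 1. 1 - d < f y \<and> s \<le> blinfun_apply \<phi> y"
    using f x by (rule not_weakly_exposesE) blast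
  \<comment> \<open>The endpoints are the two demands \<open>\<psi> f \<ge> 1\<close> and
    \<open>\<psi> \<phi> \<ge> s\<close>; Mazur--Orlicz asks that all their convex combinations stay
    below the norm.\<close>
  let ?C = "closed_segment (f, 1) (\<phi>, s)"
  have le: "b \<le> norm c" if "(c, b) \<in> ?C" for c b
  proof (rule field_le_epsilon)
    fix d :: real assume "d > 0"
    then obtain y where y: "norm y \<le> 1" "1 - d < f y" "s \<le> \<phi> y" using slice[of d] by auto
    from that obtain t where t: "0 \<le> t" "t \<le> 1"
      and c: "c = (1 - t) *\<^sub>R f + t *\<^sub>R \<phi>" and b: "b = (1 - t) + t * s"
      by (auto simp: in_segment)
    \<comment> \<open>A single slice point \<open>y\<close> tests both demands at once:
      \<open>1 \<le> f y + d\<close> and \<open>s \<le> \<phi> y\<close>. The total error is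
      \<open>(1 - t) * d\<close>, at most \<open>d\<close>.\<close>
    have "b \<le> (1 - t) * (f y + d) + t * \<phi> y"
      unfolding b using t y mult_left_mono[of 1 "f y + d" "1 - t"] by (simp add: add_mono mult_left_mono)
    also have "\<dots> \<le> c y + d"
      using t \<open>d > 0\<close> mult_right_mono[of "1 - t" 1 d] by (simp add: c blinfun.bilinear_simps algebra_simps)
    also have "\<dots> \<le> norm c + d" using blinfun_le_norm[OF y(1), of c] by simp
    finally show "b \<le> norm c + d" .
  qed
  obtain \<psi> :: "('a \<Rightarrow>\<^sub>L real) \<Rightarrow>\<^sub>L real"
    where \<psi>: "norm \<psi> \<le> 1" "\<And>c b. (c, b) \<in> ?C \<Longrightarrow> b \<le> \<psi> c"
    using Mazur_Orlicz_norm[OF convex_closed_segment le] by blast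
  have "\<psi> f \<ge> 1" "\<psi> \<phi> \<ge> s" using \<psi>(2) by auto
  moreover have "\<psi> f \<le> norm \<psi>" using f by (intro blinfun_le_norm) simp
  \<comment> \<open>The chain \<open>1 \<le> \<psi> f \<le> norm \<psi> \<le> 1\<close> forces
    equality throughout.\<close>
  ultimately have "\<psi> \<in> sphere 0 1 \<and> \<psi> f = 1" using \<psi>(1) by simp
  moreover obtain J :: "('a \<Rightarrow>\<^sub>L real) \<Rightarrow>\<^sub>L real" where J: "norm J = 1" "\<And>\<theta>. J \<theta> = \<theta> x"
    using norming_evaluation[of f x] f x fx by auto
  moreover have "J f = 1" using J fx by simp
  \<comment> \<open>Uniqueness makes \<open>\<psi>\<close> the evaluation at \<open>x\<close>, which
    contradicts \<open>\<phi> x < s \<le> \<psi> \<phi>\<close>.\<close>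
  ultimately have "\<psi> = J" using G unfolding G_smooth_point_def by auto
  then have "\<psi> \<phi> = \<phi> x" by (simp add: J)
  with \<open>\<psi> \<phi> \<ge> s\<close> \<phi> show False by simp
qed

theorem theorem2p1:
  fixes x :: "'a::banach" and f :: "'a \<Rightarrow>\<^sub>L real"
  assumes "x \<in> sphere 0 1" and "f \<in> sphere 0 1" and "blinfun_apply f x = 1"
  shows "(weakly_exposes f x \<longleftrightarrow>
            (\<forall>C. closed C \<and> convex C \<and> C \<subseteq> cball 0 1 \<and> C \<noteq> {} \<and> (SUP y\<in>C. blinfun_apply f y) = 1
                 \<longrightarrow> x \<in> C)) \<and>
         (weakly_exposes f x \<longleftrightarrow> G_smooth_point f)"
proof (intro conjI iffI)
  show "\<forall>C. closed C \<and> convex C \<and> C \<subseteq> cball 0 1 \<and> C \<noteq> {} \<and> (SUP y\<in>C. f y) = 1 \<longrightarrow> x \<in> C"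
    if "weakly_exposes f x"
    using weakly_exposes_imp_mem[OF that] by blast
  show "weakly_exposes f x"
    if "\<forall>C. closed C \<and> convex C \<and> C \<subseteq> cball 0 1 \<and> C \<noteq> {} \<and> (SUP y\<in>C. f y) = 1 \<longrightarrow> x \<in> C"
    using assms(2,1) that by (intro mem_imp_weakly_exposes) auto
  show "G_smooth_point f" if "weakly_exposes f x"
    using that assms(3) by (rule weakly_exposes_imp_G_smooth_point)
  show "weakly_exposes f x" if "G_smooth_point f"
    using assms(2,1,3) that by (rule G_smooth_point_imp_weakly_exposes)
qed

end
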